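(* Let $\alpha \in (0,\tfrac15)$ be fixed. There exist constants $\varepsilon>0$ and $C>0$ such that the following holds. Let $G\sim G(n,p)$ with $p \ge \frac{C}{n}$. Then with high probability $G$ has the following property: for every edge coloring $\chi: E(G)\to\{+1,-1\}$ there exists a spanning forest $F\in\mathcal F_\alpha(G)$ such that \[ \Bigl|\sum_{e\in E(F)} \chi(e)\Bigr| \ge \varepsilon n . \]
   Context: $G(n,p)$ denotes the binomial random graph on the vertex set $\{1,\dots,n\}$ in which each pair of distinct vertices is joined by an edge independently with probability $p$. An event holds with high probability if its probability tends to $1$ as $n\to\infty$. For a graph $G$ on $n$ vertices, let $c(G)$ be its number of connected components. $\mathcal F_G$ is the set of all spanning forests $F$ of $G$ with $c(F)=c(G)$ (i.e. maximal spanning forests, consisting of a spanning tree of each component of $G$), and $\mathcal F_\alpha(G)$ is the set of those $F\in\mathcal F_G$ having at least $\alpha n$ leaves (vertices of degree $1$ in $F$). *)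

theory Defs
  imports "HOL-Probability.Probability"
begin

text \<open>A simple graph is given by a vertex set \<open>V\<close> and a set \<open>E\<close> of two-element subsets of \<open>V\<close>.
  Spanning subgraphs share the vertex set \<open>V\<close>, so they are given by subsets of \<open>E\<close>.\<close>

definition vertex_pairs :: "'a set \<Rightarrow> 'a set set" where
  "vertex_pairs V = {e. e \<subseteq> V \<and> card e = 2}"

definition binomial_random_graph :: "nat \<Rightarrow> real \<Rightarrow> nat set set pmf" where
  "binomial_random_graph n p =
     map_pmf (\<lambda>f. {e \<in> vertex_pairs {1..n}. f e})
       (Pi_pmf (vertex_pairs {1..n}) False (\<lambda>_. bernoulli_pmf p))"

definition adjacency :: "'a set set \<Rightarrow> ('a \<times> 'a) set" where
  "adjacency E = {(u, v). {u, v} \<in> E}"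

definition graph_components :: "'a set \<Rightarrow> 'a set set \<Rightarrow> 'a set set" where
  "graph_components V E = V // {(u, v). u \<in> V \<and> v \<in> V \<and> (u, v) \<in> (adjacency E)\<^sup>*}"

definition num_components :: "'a set \<Rightarrow> 'a set set \<Rightarrow> nat" where
  "num_components V E = card (graph_components V E)"

definition is_cycle :: "'a set set \<Rightarrow> 'a list \<Rightarrow> bool" where
  "is_cycle E xs \<longleftrightarrow> 3 \<le> length xs \<and> distinct xs \<and>
     (\<forall>i < length xs. {xs ! i, xs ! (Suc i mod length xs)} \<in> E)"

definition is_forest :: "'a set set \<Rightarrow> bool" where
  "is_forest F \<longleftrightarrow> (\<nexists>xs. is_cycle F xs)"

definition vertex_degree :: "'a set set \<Rightarrow> 'a \<Rightarrow> nat" where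
  "vertex_degree E v = card {e \<in> E. v \<in> e}"

definition leaves :: "'a set \<Rightarrow> 'a set set \<Rightarrow> 'a set" where
  "leaves V F = {v \<in> V. vertex_degree F v = 1}"

definition max_spanning_forests :: "'a set \<Rightarrow> 'a set set \<Rightarrow> 'a set set set" where
  "max_spanning_forests V E =
     {F. F \<subseteq> E \<and> is_forest F \<and> num_components V F = num_components V E}"

definition leafy_spanning_forests :: "real \<Rightarrow> 'a set \<Rightarrow> 'a set set \<Rightarrow> 'a set set set" where
  "leafy_spanning_forests \<alpha> V E =
     {F \<in> max_spanning_forests V E. real (card (leaves V F)) \<ge> \<alpha> * real (card V)}"

end

theory Submission
  imports Defs
begin

text \<open>For \<open>m = n div 100\<close> and \<open>C\<close> large, a union bound shows that with high probability any two
  disjoint sets of at least \<open>m\<close> vertices are joined by an edge; the rest is deterministic.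
  If \<open>S\<close> has between \<open>m\<close> and \<open>11 m\<close> vertices, all but \<open>m\<close> of the remaining vertices have a
  neighbour in \<open>S\<close>. Attach each of them to \<open>S\<close> by an edge, of colour \<open>c\<close> whenever possible, and
  extend this star forest to a maximal spanning forest: as only few edges are added, most vertices
  stay leaves, and the colour sum is at least \<open>2 |N\<^sub>c(S)| - n\<close> in absolute value.
  So it suffices to find \<open>S\<close> and \<open>c\<close> with \<open>|N\<^sub>c(S)| \<ge> n/2 + m\<close>. Otherwise, for \<open>S\<^sub>0\<close> of size \<open>m\<close>,
  \<open>X = N\<^sub>1(S\<^sub>0)\<close> and \<open>Y = N\<^sub>-\<^sub>1(S\<^sub>0)\<close> almost partition the vertices into halves. Pick \<open>T \<subseteq> Y - X\<close> of
  size \<open>10 m\<close>. Since \<open>N\<^sub>-\<^sub>1(S\<^sub>0 \<union> T)\<close> is not much larger than \<open>Y\<close>, many vertices of \<open>X - Y\<close> have no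
  edge of colour \<open>-1\<close> to \<open>T\<close>; \<open>m\<close> of them form a set \<open>S'\<close> joined in colour \<open>1\<close> to almost all of
  \<open>T\<close>, so \<open>N\<^sub>1(S\<^sub>0 \<union> S')\<close>, which contains most of \<open>X\<close> and of \<open>T\<close>, is too large.\<close>

section \<open>Connectivity, cycles and forests\<close>

lemma adjacency_rtrancl_sym:
  assumes "(u, v) \<in> (adjacency E)\<^sup>*"
  shows "(v, u) \<in> (adjacency E)\<^sup>*"
proof -
  have "sym (adjacency E)"
    by (auto simp: sym_def adjacency_def insert_commute)
  then show ?thesis
    using assms by (meson sym_rtrancl symD)
qed

lemma equiv_connected:
  "equiv V {(u, v). u \<in> V \<and> v \<in> V \<and> (u, v) \<in> (adjacency E)\<^sup>*}"
  by (rule equivI) (auto intro!: refl_onI symI transI intro: adjacency_rtrancl_sym rtrancl_trans)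

lemma is_cycle_rotate1:
  assumes "is_cycle E xs"
  shows "is_cycle E (rotate1 xs)"
proof -
  have len: "3 \<le> length xs"
    using assms by (simp add: is_cycle_def)
  have "{rotate1 xs ! i, rotate1 xs ! (Suc i mod length xs)} \<in> E" if "i < length xs" for i
  proof -
    have "Suc i mod length xs < length xs"
      using len by (intro mod_less_divisor) linarith
    then have "rotate1 xs ! i = xs ! (Suc i mod length xs)"
      "rotate1 xs ! (Suc i mod length xs) = xs ! (Suc (Suc i mod length xs) mod length xs)"
      using that by (simp_all add: nth_rotate1)
    then show ?thesis
      using assms \<open>Suc i mod length xs < length xs\<close> by (auto simp: is_cycle_def)
  qed
  then show ?thesis
    using assms by (simp add: is_cycle_def)
qed

lemma is_cycle_rotate:
  assumes "is_cycle E xs"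
  shows "is_cycle E (rotate k xs)"
  by (induction k) (use assms in \<open>auto simp: is_cycle_rotate1\<close>)

text \<open>Normal form: a chosen vertex comes first and its cyclic predecessor last, so a chosen
  edge becomes the one that closes the list.\<close>

lemma is_cycle_rotate_to:
  assumes "is_cycle E xs" "i < length xs"
  obtains ys where "is_cycle E ys" "length ys = length xs" "set ys = set xs"
    "ys ! 0 = xs ! i" "ys ! (length ys - 1) = xs ! ((i + length xs - 1) mod length xs)"
proof
  have "3 \<le> length xs"
    using assms by (simp add: is_cycle_def)
  then have "xs \<noteq> []" by auto
  then show "rotate i xs ! 0 = xs ! i"
    "rotate i xs ! (length (rotate i xs) - 1) = xs ! ((i + length xs - 1) mod length xs)"
    using assms by (auto simp: nth_rotate add.commute)
qed (use is_cycle_rotate[OF assms(1)] in auto)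

lemma is_cycle_last_edge:
  assumes "is_cycle E xs"
  shows "{xs ! (length xs - 1), xs ! 0} \<in> E"
proof -
  have "length xs > 0"
    using assms by (auto simp: is_cycle_def)
  then have "length xs - 1 < length xs" "Suc (length xs - 1) mod length xs = 0"
    by simp_all
  then show ?thesis
    using assms unfolding is_cycle_def by metis
qed

text \<open>With \<open>v\<close> rotated to the front, the second and the last vertex differ
  because a cycle has at least three vertices.\<close>

lemma is_cycle_two_edges_at_vertex:
  assumes "is_cycle E xs" "v \<in> set xs"
  obtains e f where "e \<in> E" "f \<in> E" "v \<in> e" "v \<in> f" "e \<noteq> f"
proof -
  obtain i where i: "i < length xs" "xs ! i = v"
    using assms(2) by (auto simp: in_set_conv_nth)
  obtain ys where ys: "is_cycle E ys" "ys ! 0 = v"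
    by (rule is_cycle_rotate_to[OF assms(1) i(1)]) (use i(2) in blast)
  then have len: "3 \<le> length ys" "distinct ys" by (auto simp: is_cycle_def)
  have "{ys ! 0, ys ! (Suc 0 mod length ys)} \<in> E"
    using ys(1) len(1) by (force simp: is_cycle_def)
  then have e: "{ys ! 0, ys ! 1} \<in> E" using len by simp
  have f: "{ys ! (length ys - 1), ys ! 0} \<in> E"
    using is_cycle_last_edge[OF ys(1)] .
  have "ys ! 1 \<noteq> ys ! (length ys - 1)"
    using len by (subst nth_eq_iff_index_eq) auto
  then have "{ys ! 0, ys ! 1} \<noteq> {ys ! (length ys - 1), ys ! 0}"
    by (auto simp: doubleton_eq_iff)
  then show ?thesis
    using that e f ys(2) by blast
qed

text \<open>Induction along the walk: when the next vertex already lies on the path, the path is cut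
  back to it instead of being prolonged.\<close>

lemma rtrancl_adjacency_distinct_path:
  assumes "(u, v) \<in> (adjacency E)\<^sup>*"
  obtains xs where "xs \<noteq> []" "distinct xs" "hd xs = u" "last xs = v"
    "\<And>i. Suc i < length xs \<Longrightarrow> {xs ! i, xs ! Suc i} \<in> E"
proof -
  have "\<exists>xs. xs \<noteq> [] \<and> distinct xs \<and> hd xs = u \<and> last xs = v \<and>
          (\<forall>i. Suc i < length xs \<longrightarrow> {xs ! i, xs ! Suc i} \<in> E)"
    using assms
  proof (induction rule: rtrancl_induct)
    case base
    show ?case by (rule exI[of _ "[u]"]) simp
  next
    case (step v w)
    then obtain xs where xs: "xs \<noteq> []" "distinct xs" "hd xs = u" "last xs = v"
      "\<forall>i. Suc i < length xs \<longrightarrow> {xs ! i, xs ! Suc i} \<in> E" by blast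
    have vw: "{v, w} \<in> E" using step by (simp add: adjacency_def)
    show ?case
    proof (cases "w \<in> set xs")
      case True
      then obtain k where k: "k < length xs" "xs ! k = w"
        by (auto simp: in_set_conv_nth)
      have "last (take (Suc k) xs) = w"
        using k by (simp add: take_Suc_conv_app_nth)
      then show ?thesis
        using xs k by (intro exI[of _ "take (Suc k) xs"]) auto
    next
      case False
      have "{(xs @ [w]) ! i, (xs @ [w]) ! Suc i} \<in> E" if "Suc i < length (xs @ [w])" for i
      proof (cases "Suc i < length xs")
        case True
        then show ?thesis using xs(5) by (simp add: nth_append)
      next
        case False
        then have "Suc i = length xs" using that by simp
        then show ?thesis
          using vw xs(1,4) by (simp add: nth_append last_conv_nth flip: \<open>Suc i = length xs\<close>)
      qed
      then show ?thesis
        using xs False by (intro exI[of _ "xs @ [w]"]) auto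
    qed
  qed
  then show ?thesis using that by blast
qed

text \<open>A path in \<open>F\<close> from \<open>u\<close> to \<open>v\<close> would be closed to
  a cycle by the new edge. It has at least three vertices: one is excluded by
  \<open>u \<noteq> v\<close>, two by \<open>{u, v} \<notin> F\<close>.\<close>

lemma is_forest_insert_imp_not_connected:
  assumes "is_forest (insert {u, v} F)" "{u, v} \<notin> F" "u \<noteq> v"
  shows "(u, v) \<notin> (adjacency F)\<^sup>*"
proof
  assume "(u, v) \<in> (adjacency F)\<^sup>*"
  then obtain xs where xs: "xs \<noteq> []" "distinct xs" "hd xs = u" "last xs = v"
    "\<And>i. Suc i < length xs \<Longrightarrow> {xs ! i, xs ! Suc i} \<in> F"
    by (rule rtrancl_adjacency_distinct_path) blast
  have ends: "xs ! 0 = u" "xs ! (length xs - 1) = v"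
    using xs by (simp_all add: hd_conv_nth last_conv_nth)
  have "length xs \<noteq> 0" "length xs \<noteq> 1" "length xs \<noteq> 2"
    using xs(1) xs(5)[of 0] ends assms(2,3) by auto
  then have len: "3 \<le> length xs" by linarith
  have "{xs ! i, xs ! (Suc i mod length xs)} \<in> insert {u, v} F" if "i < length xs" for i
  proof (cases "Suc i < length xs")
    case True
    then show ?thesis using xs(5) by simp
  next
    case False
    then have "Suc i = length xs" using that by simp
    then have "i = length xs - 1" by simp
    then have "xs ! i = v" "xs ! (Suc i mod length xs) = u"
      using ends \<open>Suc i = length xs\<close> by simp_all
    then show ?thesis
      by (simp add: insert_commute)
  qed
  then have "is_cycle (insert {u, v} F) xs"
    using len xs(2) by (simp add: is_cycle_def)
  then show False
    using assms(1) by (auto simp: is_forest_def)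
qed

text \<open>Any cycle must use the new edge. Rotated so that this edge closes the list, the cycle
  leaves a path in \<open>F\<close> between its ends.\<close>

lemma not_is_forest_insert_imp_connected:
  assumes "is_forest F" "\<not> is_forest (insert {u, v} F)"
  shows "(u, v) \<in> (adjacency F)\<^sup>*"
proof -
  obtain xs where xs: "is_cycle (insert {u, v} F) xs"
    using assms(2) by (auto simp: is_forest_def)
  have "\<not> is_cycle F xs"
    using assms(1) by (auto simp: is_forest_def)
  then obtain i where i: "i < length xs" "{xs ! i, xs ! (Suc i mod length xs)} = {u, v}"
    using xs by (auto simp: is_cycle_def)
  define j where "j = Suc i mod length xs"
  have len: "3 \<le> length xs"
    using xs by (simp add: is_cycle_def)
  then have j: "j < length xs"
    unfolding j_def by (intro mod_less_divisor) linarith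
  \<comment> \<open>\<open>j\<close> is the cyclic successor of \<open>i\<close>, so rotating
    \<open>j\<close> to the front puts \<open>i\<close> last; the case split treats the
    wrap-around.\<close>
  have "(j + length xs - 1) mod length xs = i"
    using i(1) len unfolding j_def by (cases "Suc i = length xs") auto
  then obtain ys where ys: "is_cycle (insert {u, v} F) ys"
    "ys ! 0 = xs ! j" "ys ! (length ys - 1) = xs ! i"
    using is_cycle_rotate_to[OF xs j] by metis
  have ends: "{ys ! (length ys - 1), ys ! 0} = {u, v}"
    using i(2) ys(2,3) by (simp add: j_def)
  have ylen: "3 \<le> length ys" "distinct ys"
    using ys(1) by (simp_all add: is_cycle_def)
  have edge: "{ys ! k, ys ! Suc k} \<in> F" if "Suc k < length ys" for k
  proof -
    have "{ys ! k, ys ! (Suc k mod length ys)} \<in> insert {u, v} F"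
      using ys(1) Suc_lessD[OF that] unfolding is_cycle_def by blast
    \<comment> \<open>No inner edge equals the closing one: \<open>ys ! Suc k\<close> is not the
      first vertex, so equality would force both \<open>k = 0\<close> and
      \<open>Suc k = length ys - 1\<close>, impossible with three or more vertices.\<close>
    moreover have "0 < length ys" "k < length ys" "length ys - 1 < length ys"
      using that by (linarith, linarith, linarith)
    then have "ys ! Suc k = ys ! 0 \<longleftrightarrow> Suc k = 0" "ys ! k = ys ! 0 \<longleftrightarrow> k = 0"
      "ys ! Suc k = ys ! (length ys - 1) \<longleftrightarrow> Suc k = length ys - 1"
      using that ylen(2) by (simp_all only: nth_eq_iff_index_eq)
    then have "ys ! Suc k \<noteq> ys ! 0" "ys ! k \<noteq> ys ! 0 \<or> ys ! Suc k \<noteq> ys ! (length ys - 1)"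
      using ylen(1) by (simp, linarith)
    then have "{ys ! k, ys ! Suc k} \<noteq> {ys ! (length ys - 1), ys ! 0}"
      by (auto simp: doubleton_eq_iff)
    ultimately show ?thesis
      using ends that by simp
  qed
  have path: "(ys ! 0, ys ! k) \<in> (adjacency F)\<^sup>*" if "k < length ys" for k
    using that
  proof (induction k)
    case (Suc k)
    then have "(ys ! 0, ys ! k) \<in> (adjacency F)\<^sup>*" by simp
    moreover have "(ys ! k, ys ! Suc k) \<in> adjacency F"
      using edge[OF Suc.prems] by (simp add: adjacency_def)
    ultimately show ?case by (rule rtrancl_into_rtrancl)
  qed simp
  have "(ys ! 0, ys ! (length ys - 1)) \<in> (adjacency F)\<^sup>*"
    using path ylen by simp
  then show ?thesis
    using ends by (auto simp: doubleton_eq_iff intro: adjacency_rtrancl_sym)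
qed

section \<open>Maximal spanning forests and their number of edges\<close>

lemma is_forest_mono: "is_forest F" if "is_forest G" "F \<subseteq> G"
  using that unfolding is_forest_def is_cycle_def by blast

lemma finite_vertex_pairs: "finite V \<Longrightarrow> finite (vertex_pairs V)"
  by (rule finite_subset[of _ "Pow V"]) (auto simp: vertex_pairs_def)

lemma vertex_pairsE:
  assumes "e \<in> vertex_pairs V"
  obtains u v where "e = {u, v}" "u \<noteq> v" "u \<in> V" "v \<in> V"
  using assms by (auto simp: vertex_pairs_def card_2_iff)

text \<open>An inclusion-maximal forest between \<open>F0\<close> and \<open>E\<close> connects the
  ends of every edge of \<open>E\<close>, since a rejected edge would have closed a cycle. Hence it
  has the same components as \<open>E\<close>.\<close>

lemma extend_to_max_spanning_forest:
  assumes "finite E" "E \<subseteq> vertex_pairs V" "F0 \<subseteq> E" "is_forest F0"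
  obtains F where "F \<in> max_spanning_forests V E" "F0 \<subseteq> F"
proof -
  define A where "A = {F. F0 \<subseteq> F \<and> F \<subseteq> E \<and> is_forest F}"
  have "finite A"
    using assms(1) by (auto simp: A_def intro: finite_subset[of _ "Pow E"])
  moreover have "F0 \<in> A" using assms by (simp add: A_def)
  ultimately obtain F where F: "F \<in> A" "\<And>G. G \<in> A \<Longrightarrow> F \<subseteq> G \<Longrightarrow> F = G"
    using finite_has_maximal[of A] by blast
  have "adjacency E \<subseteq> (adjacency F)\<^sup>*"
  proof (rule subrelI)
    fix u v assume "(u, v) \<in> adjacency E"
    then have uv: "{u, v} \<in> E" by (simp add: adjacency_def)
    show "(u, v) \<in> (adjacency F)\<^sup>*"
    proof (cases "{u, v} \<in> F")
      case True
      then show ?thesis by (auto simp: adjacency_def)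
    next
      case False
      have "\<not> is_forest (insert {u, v} F)"
      proof
        assume "is_forest (insert {u, v} F)"
        then have "insert {u, v} F \<in> A" using F(1) uv by (auto simp: A_def)
        then show False using F(2) False by blast
      qed
      then show ?thesis
        using F(1) not_is_forest_insert_imp_connected by (auto simp: A_def)
    qed
  qed
  moreover have "adjacency F \<subseteq> adjacency E"
    using F(1) by (auto simp: A_def adjacency_def)
  ultimately have "(adjacency F)\<^sup>* = (adjacency E)\<^sup>*"
    by (metis rtrancl_subset)
  then have "num_components V F = num_components V E"
    by (simp add: num_components_def graph_components_def)
  then show ?thesis
    using that F(1) by (auto simp: A_def max_spanning_forests_def)
qed

text \<open>The map \<open>h\<close> sends each old component to the new component containing it. It
  is onto, and it is not injective because the distinct components of \<open>u\<close> and
  \<open>v\<close> merge.\<close>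

lemma num_components_insert_less:
  assumes "finite V" "u \<in> V" "v \<in> V" "(u, v) \<notin> (adjacency F)\<^sup>*"
  shows "num_components V (insert {u, v} F) < num_components V F"
proof -
  let ?R = "\<lambda>F. {(u, v). u \<in> V \<and> v \<in> V \<and> (u, v) \<in> (adjacency F)\<^sup>*}"
  let ?G = "insert {u, v} F"
  have eq: "equiv V (?R F)" "equiv V (?R ?G)"
    by (rule equiv_connected)+
  have mono: "(adjacency F)\<^sup>* \<subseteq> (adjacency ?G)\<^sup>*"
    by (rule rtrancl_mono) (auto simp: adjacency_def)
  define h where "h = (\<lambda>C. ?R ?G `` C)"
  have h: "h (?R F `` {x}) = ?R ?G `` {x}" if "x \<in> V" for x
  proof (intro equalityI subsetI)
    fix y assume "y \<in> h (?R F `` {x})"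
    then show "y \<in> ?R ?G `` {x}"
      unfolding h_def using that mono by (auto intro: rtrancl_trans)
  next
    fix y assume "y \<in> ?R ?G `` {x}"
    then show "y \<in> h (?R F `` {x})"
      unfolding h_def using that by blast
  qed
  have fin: "finite (graph_components V F)"
    unfolding graph_components_def using assms(1) by (rule finite_quotient) auto
  have img: "h ` graph_components V F = graph_components V ?G"
    unfolding graph_components_def quotient_def using h by (auto simp: image_UN)
  have "\<not> inj_on h (graph_components V F)"
  proof
    assume inj: "inj_on h (graph_components V F)"
    have "(u, v) \<in> adjacency ?G"
      by (simp add: adjacency_def)
    then have "(u, v) \<in> (adjacency ?G)\<^sup>*" ..
    then have "?R ?G `` {u} = ?R ?G `` {v}"
      using assms(2,3) by (intro equiv_class_eq[OF eq(2)]) auto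
    then have "h (?R F `` {u}) = h (?R F `` {v})"
      using assms(2,3) h by simp
    then have "?R F `` {u} = ?R F `` {v}"
      by (rule inj_onD[OF inj])
        (unfold graph_components_def, (rule quotientI, fact)+)
    then show False
      using assms(3,4) eq_equiv_class[OF _ eq(1), of u v] by simp
  qed
  then have "card (h ` graph_components V F) \<noteq> card (graph_components V F)"
    using eq_card_imp_inj_on[OF fin] by blast
  then show ?thesis
    unfolding num_components_def
    using card_image_le[OF fin, of h] by (simp add: img)
qed

text \<open>Starting from at most \<open>card V\<close> components without edges, each further edge
  of a forest lowers their number by at least one.\<close>

lemma forest_card_le:
  assumes "finite V" "F \<subseteq> vertex_pairs V" "is_forest F"
  shows "card F + num_components V F \<le> card V"
proof -
  have "finite F"
    using finite_subset[OF assms(2) finite_vertex_pairs[OF assms(1)]] .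
  then show ?thesis
    using assms(2,3)
  proof (induction F rule: finite_induct)
    case empty
    have "{(u, v). u \<in> V \<and> v \<in> V \<and> (u, v) \<in> (adjacency {})\<^sup>*} = Id_on V"
      by (auto simp: adjacency_def)
    moreover have "V // Id_on V = (\<lambda>x. {x}) ` V"
      by (auto simp: quotient_def)
    ultimately show ?case
      by (simp add: num_components_def graph_components_def card_image_le assms(1))
  next
    case (insert e F)
    obtain u v where e: "e = {u, v}" "u \<noteq> v" "u \<in> V" "v \<in> V"
      using insert.prems(1) by (auto elim: vertex_pairsE)
    have "(u, v) \<notin> (adjacency F)\<^sup>*"
      using is_forest_insert_imp_not_connected[of u v F] insert.prems(2) insert.hyps(2) e(1,2)
      by simp
    then have "num_components V (insert e F) < num_components V F"
      using num_components_insert_less[OF assms(1) e(3,4)] e(1) by simp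
    moreover have "card F + num_components V F \<le> card V"
      using insert is_forest_mono[of "insert e F" F] by blast
    ultimately show ?case
      using insert by simp
  qed
qed

section \<open>Star forests and their leaves\<close>

text \<open>Every edge contains some \<open>w\<close> in \<open>W\<close>, and
  \<open>{w, g w}\<close> is the only edge at \<open>w\<close> because \<open>g\<close> avoids
  \<open>W\<close>; a cycle would need two edges there.\<close>

lemma is_forest_stars:
  assumes "g ` W \<inter> W = {}"
  shows "is_forest ((\<lambda>v. {v, g v}) ` W)"
  unfolding is_forest_def
proof
  assume "\<exists>xs. is_cycle ((\<lambda>v. {v, g v}) ` W) xs"
  then obtain xs where xs: "is_cycle ((\<lambda>v. {v, g v}) ` W) xs" ..
  then have "{xs ! (length xs - 1), xs ! 0} \<in> (\<lambda>v. {v, g v}) ` W"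
    by (rule is_cycle_last_edge)
  then obtain w where w: "w \<in> W" "{xs ! (length xs - 1), xs ! 0} = {w, g w}"
    by (elim imageE)
  have "0 < length xs"
    using xs by (auto simp: is_cycle_def)
  then have "xs ! (length xs - 1) \<in> set xs" "xs ! 0 \<in> set xs"
    by simp_all
  then have "{w, g w} \<subseteq> set xs"
    unfolding w(2)[symmetric] by simp
  then have "w \<in> set xs" by simp
  then obtain e f where ef: "e \<in> (\<lambda>v. {v, g v}) ` W" "f \<in> (\<lambda>v. {v, g v}) ` W" "w \<in> e" "w \<in> f" "e \<noteq> f"
    by (rule is_cycle_two_edges_at_vertex[OF xs])
  have "e = {w, g w}" if e: "e \<in> (\<lambda>v. {v, g v}) ` W" "w \<in> e" for e
  proof -
    obtain v where v: "v \<in> W" "e = {v, g v}" using e(1) by (elim imageE)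
    then have "w = v" using e(2) w(1) assms by auto
    then show ?thesis using v by simp
  qed
  then show False using ef by blast
qed

text \<open>\<open>F\<close> has at most \<open>card V\<close> edges, so at most
  \<open>card V - card W\<close> lie outside the stars. These touch at most twice as many vertices
  (the set \<open>U\<close>), and every other vertex of \<open>W\<close> is a leaf. This leaves at
  least \<open>3 * card W - 2 * card V\<close> leaves.\<close>

lemma star_forest_extension:
  assumes "finite V" "E \<subseteq> vertex_pairs V" "W \<subseteq> V" "g ` W \<inter> W = {}"
    and "\<And>v. v \<in> W \<Longrightarrow> {v, g v} \<in> E"
  obtains F where "F \<in> max_spanning_forests V E" "(\<lambda>v. {v, g v}) ` W \<subseteq> F"
    "card F \<le> card V" "3 * card W \<le> card (leaves V F) + 2 * card V"
proof -
  define F0 where "F0 = (\<lambda>v. {v, g v}) ` W"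
  have finE: "finite E"
    using finite_subset[OF assms(2) finite_vertex_pairs[OF assms(1)]] .
  have F0E: "F0 \<subseteq> E" using assms(5) by (auto simp: F0_def)
  obtain F where F: "F \<in> max_spanning_forests V E" "F0 \<subseteq> F"
    by (rule extend_to_max_spanning_forest[OF finE assms(2) F0E])
      (simp add: F0_def is_forest_stars[OF assms(4)])
  have FE: "F \<subseteq> E" "is_forest F" using F(1) by (auto simp: max_spanning_forests_def)
  then have finF: "finite F" using finE finite_subset by blast
  have cardF: "card F \<le> card V"
    using forest_card_le[OF assms(1) _ FE(2)] FE(1) assms(2) by fastforce
  have inj: "inj_on (\<lambda>v. {v, g v}) W"
    using assms(4) by (auto simp: inj_on_def doubleton_eq_iff)
  then have cardF0: "card F0 = card W"
    by (simp add: F0_def card_image)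
  define U where "U = \<Union> (F - F0)"
  have card2: "card e = 2" "finite e" if "e \<in> F" for e
    using that FE assms(2) by (auto simp: vertex_pairs_def card_2_iff)
  have "card U \<le> (\<Sum>e\<in>F - F0. card e)"
    unfolding U_def by (rule card_Union_le_sum_card)
  also have "\<dots> = 2 * card (F - F0)"
    using card2 by simp
  also have "\<dots> = 2 * (card F - card W)"
    using F(2) finF cardF0 by (simp add: card_Diff_subset finite_subset)
  finally have cardU: "card U \<le> 2 * (card F - card W)" .
  have "W - U \<subseteq> leaves V F"
  proof
    fix v assume v: "v \<in> W - U"
    have "{e \<in> F. v \<in> e} = {{v, g v}}"
    proof (intro equalityI subsetI)
      fix e assume e: "e \<in> {e \<in> F. v \<in> e}"
      then have "e \<in> F0" using v unfolding U_def by blast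
      then obtain w where w: "w \<in> W" "e = {w, g w}" unfolding F0_def by (elim imageE)
      then have "v = w" using e v assms(4) by blast
      then show "e \<in> {{v, g v}}" using w by simp
    next
      fix e assume "e \<in> {{v, g v}}"
      then show "e \<in> {e \<in> F. v \<in> e}" using v F(2) unfolding F0_def by blast
    qed
    then show "v \<in> leaves V F"
      using v assms(3) by (auto simp: leaves_def vertex_degree_def)
  qed
  then have "card (W - U) \<le> card (leaves V F)"
    using assms(1) by (intro card_mono) (auto simp: leaves_def)
  moreover have "card W - card U \<le> card (W - U)"
    by (rule diff_card_le_card_Diff) (use finF card2 in \<open>auto simp: U_def\<close>)
  moreover have "card W \<le> card F"
    using card_mono[OF finF F(2)] cardF0 by simp
  ultimately have "3 * card W \<le> card (leaves V F) + 2 * card V"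
    using cardU cardF by linarith
  then show ?thesis
    using that F cardF unfolding F0_def by blast
qed

section \<open>The deterministic argument: coloured neighbourhoods\<close>

text \<open>The only probabilistic input to the deterministic argument.\<close>

definition joined :: "nat \<Rightarrow> 'a set \<Rightarrow> 'a set set \<Rightarrow> bool" where
  "joined m V E \<longleftrightarrow> (\<forall>A B. A \<subseteq> V \<longrightarrow> B \<subseteq> V \<longrightarrow> A \<inter> B = {} \<longrightarrow> m \<le> card A \<longrightarrow> m \<le> card B \<longrightarrow>
     (\<exists>a\<in>A. \<exists>b\<in>B. {a, b} \<in> E))"

text \<open>Vertices of \<open>S\<close> are excluded so that edges chosen from these vertices into
  \<open>S\<close> form stars centred in \<open>S\<close>.\<close>

definition colour_nbrs :: "'a set \<Rightarrow> 'a set set \<Rightarrow> ('a set \<Rightarrow> int) \<Rightarrow> int \<Rightarrow> 'a set \<Rightarrow> 'a set" where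
  "colour_nbrs V E col c S = {v \<in> V - S. \<exists>s\<in>S. {v, s} \<in> E \<and> col {v, s} = c}"

lemma joined_card_nonadjacent_less:
  assumes "joined m V E" "A \<subseteq> V" "S \<subseteq> V" "A \<inter> S = {}" "m \<le> card S"
  shows "card {v \<in> A. \<forall>s\<in>S. {v, s} \<notin> E} < m"
proof (rule ccontr)
  assume "\<not> ?thesis"
  then have "\<exists>a\<in>{v \<in> A. \<forall>s\<in>S. {v, s} \<notin> E}. \<exists>b\<in>S. {a, b} \<in> E"
    using assms by (intro assms(1)[unfolded joined_def, rule_format]) auto
  then show False by blast
qed

lemma joined_card_nbrs:
  assumes "finite V" "joined m V E" "S \<subseteq> V" "m \<le> card S"
  shows "card V < card S + m + card {v \<in> V - S. \<exists>s\<in>S. {v, s} \<in> E}"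
proof -
  let ?W = "{v \<in> V - S. \<exists>s\<in>S. {v, s} \<in> E}"
  let ?U = "{v \<in> V - S. \<forall>s\<in>S. {v, s} \<notin> E}"
  have "V = S \<union> ?U \<union> ?W"
    using assms(3) by blast
  then have "card V \<le> card S + card ?U + card ?W"
    using card_Un_le[of "S \<union> ?U" ?W] card_Un_le[of S ?U] by simp
  moreover have "card ?U < m"
    using assms by (intro joined_card_nonadjacent_less[of m V]) auto
  ultimately show ?thesis by linarith
qed

lemma colour_nbrs_cover:
  assumes "\<forall>e\<in>E. col e \<in> {1, - 1}"
  shows "{v \<in> V - S. \<exists>s\<in>S. {v, s} \<in> E} = colour_nbrs V E col 1 S \<union> colour_nbrs V E col (- 1) S"
proof (intro equalityI subsetI)
  fix v assume "v \<in> {v \<in> V - S. \<exists>s\<in>S. {v, s} \<in> E}"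
  then obtain s where s: "v \<in> V - S" "s \<in> S" "{v, s} \<in> E" by blast
  then have "col {v, s} = 1 \<or> col {v, s} = - 1" using assms by simp
  then show "v \<in> colour_nbrs V E col 1 S \<union> colour_nbrs V E col (- 1) S"
    using s unfolding colour_nbrs_def by blast
qed (auto simp: colour_nbrs_def)

text \<open>After multiplication by \<open>c\<close>, edges of \<open>P\<close> contribute 1 and all
  others at least -1.\<close>

lemma sum_signs_ge:
  fixes col :: "'b \<Rightarrow> int"
  assumes "finite F" "P \<subseteq> F" "\<And>e. e \<in> F \<Longrightarrow> col e \<in> {1, - 1}"
    and "\<And>e. e \<in> P \<Longrightarrow> col e = c" and "c \<in> {1, - 1}"
  shows "2 * int (card P) - int (card F) \<le> \<bar>\<Sum>e\<in>F. col e\<bar>"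
proof -
  have "c * c = 1" using assms(5) by auto
  have "(\<Sum>e\<in>F. c * col e) = (\<Sum>e\<in>F - P. c * col e) + (\<Sum>e\<in>P. c * col e)"
    by (rule sum.subset_diff[OF assms(2,1)])
  moreover have "(\<Sum>e\<in>P. c * col e) = int (card P)"
    using assms(4) \<open>c * c = 1\<close> by simp
  moreover have "(\<Sum>e\<in>F - P. - 1) \<le> (\<Sum>e\<in>F - P. c * col e)"
  proof (rule sum_mono)
    fix e assume "e \<in> F - P"
    then have "col e \<in> {1, - 1}" using assms(3) by blast
    then show "- 1 \<le> c * col e" using assms(5) by auto
  qed
  moreover have "int (card (F - P)) = int (card F) - int (card P)"
    using assms(1,2) card_mono[OF assms(1,2)] by (simp add: card_Diff_subset finite_subset of_nat_diff)
  ultimately have "2 * int (card P) - int (card F) \<le> c * (\<Sum>e\<in>F. col e)"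
    by (simp add: sum_distrib_left)
  also have "\<dots> \<le> \<bar>\<Sum>e\<in>F. col e\<bar>"
    using assms(5) by auto
  finally show ?thesis .
qed

lemma discrepant_forest_if_biased_nbrs:
  assumes "finite V" "E \<subseteq> vertex_pairs V" "joined m V E" "\<forall>e\<in>E. col e \<in> {1, - 1 :: int}"
    and "S \<subseteq> V" "m \<le> card S" "c \<in> {1, - 1}"
  obtains F where "F \<in> max_spanning_forests V E"
    "card V \<le> card (leaves V F) + 3 * (card S + m)"
    "2 * int (card (colour_nbrs V E col c S)) - int (card V) \<le> \<bar>\<Sum>e\<in>F. col e\<bar>"
proof -
  let ?N = "colour_nbrs V E col c S"
  define W where "W = {v \<in> V - S. \<exists>s\<in>S. {v, s} \<in> E}"
  have NW: "?N \<subseteq> W" by (auto simp: colour_nbrs_def W_def)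
  \<comment> \<open>The implication lets a single choice function serve all of \<open>W\<close>
    while preferring colour \<open>c\<close> wherever it is available.\<close>
  have "\<forall>v\<in>W. \<exists>s. s \<in> S \<and> {v, s} \<in> E \<and> (v \<in> ?N \<longrightarrow> col {v, s} = c)"
    by (auto simp: W_def colour_nbrs_def)
  then obtain g where g: "\<forall>v\<in>W. g v \<in> S \<and> {v, g v} \<in> E \<and> (v \<in> ?N \<longrightarrow> col {v, g v} = c)"
    by (rule bchoice[THEN exE])
  have "g v \<in> S" if "v \<in> W" for v
    using g that by simp
  then have W: "W \<subseteq> V" "g ` W \<inter> W = {}"
    by (auto simp: W_def)
  have gE: "{v, g v} \<in> E" if "v \<in> W" for v
    using g that by simp
  obtain F where F: "F \<in> max_spanning_forests V E" "(\<lambda>v. {v, g v}) ` W \<subseteq> F"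
    "card F \<le> card V" "3 * card W \<le> card (leaves V F) + 2 * card V"
    by (rule star_forest_extension[OF assms(1,2) W gE])
  have "card V < card S + m + card W"
    using joined_card_nbrs[OF assms(1,3,5,6)] by (simp add: W_def)
  \<comment> \<open>\<open>W\<close> misses fewer than \<open>card S + m\<close> vertices, which is
    inserted into the leaf bound \<open>3 * card W - 2 * card V\<close>.\<close>
  then have leaves: "card V \<le> card (leaves V F) + 3 * (card S + m)"
    using F(4) by (simp add: algebra_simps)
  have FE: "F \<subseteq> E" using F(1) by (simp add: max_spanning_forests_def)
  have finF: "finite F"
    using finite_subset[OF subset_trans[OF FE assms(2)] finite_vertex_pairs[OF assms(1)]] .
  let ?P = "(\<lambda>v. {v, g v}) ` ?N"
  have "inj_on (\<lambda>v. {v, g v}) W"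
    using W(2) by (auto simp: inj_on_def doubleton_eq_iff)
  then have "card ?P = card ?N"
    using NW by (intro card_image) (rule inj_on_subset)
  moreover have "2 * int (card ?P) - int (card F) \<le> \<bar>\<Sum>e\<in>F. col e\<bar>"
  proof (rule sum_signs_ge[OF finF _ _ _ assms(7)])
    show "?P \<subseteq> F" using image_mono[OF NW] F(2) by (rule subset_trans)
    show "col e \<in> {1, - 1}" if "e \<in> F" for e
      using that FE assms(4) by blast
    show "col e = c" if "e \<in> ?P" for e
      using that
    proof (rule imageE)
      fix v assume "e = {v, g v}" "v \<in> ?N"
      then show ?thesis using g NW by auto
    qed
  qed
  ultimately have "2 * int (card ?N) - int (card V) \<le> \<bar>\<Sum>e\<in>F. col e\<bar>"
    using F(3) by linarith
  then show ?thesis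
    using that F(1) leaves by blast
qed

lemma joined_imp_biased_nbrs:
  assumes "finite V" "joined m V E" "\<forall>e\<in>E. col e \<in> {1, - 1 :: int}" "100 * m \<le> card V"
  obtains S c where "S \<subseteq> V" "m \<le> card S" "card S \<le> 11 * m" "c \<in> {1, - 1}"
    "card V + 2 * m \<le> 2 * card (colour_nbrs V E col c S)"
proof -
  define N where "N = colour_nbrs V E col"
  have finN: "finite (N c S)" for c S
    using assms(1) by (simp add: N_def colour_nbrs_def)
  have False if nobias: "\<And>S c. S \<subseteq> V \<Longrightarrow> m \<le> card S \<Longrightarrow> card S \<le> 11 * m \<Longrightarrow> c \<in> {1, - 1} \<Longrightarrow>
    2 * card (N c S) < card V + 2 * m"
  proof -
    have "m \<le> card V" using assms(4) by linarith
    then obtain S0 where S0: "S0 \<subseteq> V" "card S0 = m" "finite S0"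
      by (rule obtain_subset_with_card_n)
    define X where "X = N 1 S0"
    define Y where "Y = N (- 1) S0"
    have fin: "finite X" "finite Y" using finN by (simp_all add: X_def Y_def)
    have X: "2 * card X < card V + 2 * m" and Y: "2 * card Y < card V + 2 * m"
      using nobias[of S0] S0 by (simp_all add: X_def Y_def)
    have XY: "card V < 2 * m + card (X \<union> Y)"
      using joined_card_nbrs[OF assms(1,2) S0(1)] S0(2) colour_nbrs_cover[OF assms(3)]
      by (simp add: X_def Y_def N_def)
    have XuY: "card (X \<union> Y) = card X + card (Y - X)" "card (X \<union> Y) = card Y + card (X - Y)"
      using fin card_Un_disjoint[of X "Y - X"] card_Un_disjoint[of Y "X - Y"]
      by (simp_all add: Un_commute)
    \<comment> \<open>With n = \<open>card V\<close>, \<open>X \<union> Y\<close> has more than n -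
      2m elements and \<open>X\<close> fewer than n/2 + m, so \<open>Y - X\<close> has more than n/2
      - 3m, that is, over 47m. The same bound holds for \<open>X - Y\<close>, and hence for
      \<open>X\<close> and \<open>Y\<close>.\<close>
    have "10 * m \<le> card (Y - X)"
      using XY XuY X assms(4) by linarith
    then obtain T where T: "T \<subseteq> Y - X" "card T = 10 * m" "finite T"
      by (rule obtain_subset_with_card_n)
    have disj: "X \<subseteq> V - S0" "Y \<subseteq> V - S0"
      by (auto simp: X_def Y_def N_def colour_nbrs_def)
    have S0T: "card (S0 \<union> T) = 11 * m" "S0 \<union> T \<subseteq> V"
    proof -
      have "S0 \<inter> T = {}" using T(1) disj by blast
      then show "card (S0 \<union> T) = 11 * m"
        using S0 T by (simp add: card_Un_disjoint)
      show "S0 \<union> T \<subseteq> V" using S0(1) T(1) disj by blast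
    qed
    \<comment> \<open>The vertices of \<open>X - Y\<close> that become new neighbours of colour -1
      once \<open>T\<close> is added to \<open>S0\<close>.\<close>
    define Z where "Z = N (- 1) T \<inter> (X - Y)"
    have "(Y - T) \<union> Z \<subseteq> N (- 1) (S0 \<union> T)"
      using disj by (auto simp: Z_def Y_def N_def colour_nbrs_def)
    then have "card (Y - T) + card Z \<le> card (N (- 1) (S0 \<union> T))"
      using card_mono[OF finN] fin finN
      by (subst card_Un_disjoint[symmetric]) (auto simp: Z_def)
    moreover have "2 * card (N (- 1) (S0 \<union> T)) < card V + 2 * m"
      using S0T by (intro nobias) auto
    moreover have "card (Y - T) + 10 * m = card Y"
    proof -
      have "T \<subseteq> Y" using T(1) by blast
      then show ?thesis
        using T card_Diff_subset[of T Y] card_mono[of Y T] fin by simp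
    qed
    \<comment> \<open>Replacing \<open>T\<close> by \<open>Z\<close> in \<open>Y\<close> gives fewer
      than n/2 + m elements, while \<open>Y\<close> has more than n/2 - 3m: the difference 4m plus
      the 10m lost with \<open>T\<close> bounds \<open>Z\<close>.\<close>
    ultimately have Z: "card Z \<le> 14 * m"
      using X XY XuY Y card_Un_le[of X Y] by linarith
    have "card (X - Y) \<le> card Z + card (X - Y - Z)"
      using card_Un_le[of Z "X - Y - Z"] by (simp add: Z_def Un_absorb1)
    then have "m \<le> card (X - Y - Z)"
      using Z XY XuY Y assms(4) by linarith
    then obtain S' where S': "S' \<subseteq> X - Y - Z" "card S' = m" "finite S'"
      by (rule obtain_subset_with_card_n)
    have S0S': "card (S0 \<union> S') = 2 * m" "S0 \<union> S' \<subseteq> V"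
    proof -
      have "S0 \<inter> S' = {}" using S'(1) disj by blast
      then show "card (S0 \<union> S') = 2 * m"
        using S0 S' by (simp add: card_Un_disjoint)
      show "S0 \<union> S' \<subseteq> V" using S0(1) S'(1) disj by blast
    qed
    define T' where "T' = {t \<in> T. \<exists>s\<in>S'. {t, s} \<in> E}"
    have "card {t \<in> T. \<forall>s\<in>S'. {t, s} \<notin> E} < m"
      using S' T disj by (intro joined_card_nonadjacent_less[OF assms(2)]) auto
    moreover have "T = T' \<union> {t \<in> T. \<forall>s\<in>S'. {t, s} \<notin> E}"
      by (auto simp: T'_def)
    ultimately have T': "10 * m < card T' + m"
      using card_Un_le[of T' "{t \<in> T. \<forall>s\<in>S'. {t, s} \<notin> E}"] T(2) by simp
    \<comment> \<open>\<open>S'\<close> avoids \<open>Z\<close>, so no edge between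
      \<open>S'\<close> and \<open>T\<close> has colour -1.\<close>
    have "T' \<subseteq> N 1 (S0 \<union> S')"
    proof
      fix t assume "t \<in> T'"
      then obtain s where t: "t \<in> T" "s \<in> S'" "{t, s} \<in> E" by (auto simp: T'_def)
      have "s \<notin> N (- 1) T" using t(2) S' by (auto simp: Z_def)
      moreover have "s \<in> V - T" using t(2) S' T disj by blast
      ultimately have "col {t, s} \<noteq> - 1"
        using t by (auto simp: N_def colour_nbrs_def insert_commute)
      then have "col {t, s} = 1" using assms(3) t(3) by auto
      moreover have "t \<in> V - (S0 \<union> S')" using t(1) T S' disj by blast
      ultimately show "t \<in> N 1 (S0 \<union> S')"
        using t by (auto simp: N_def colour_nbrs_def)
    qed
    moreover have "X - S' \<subseteq> N 1 (S0 \<union> S')"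
      by (auto simp: X_def N_def colour_nbrs_def)
    ultimately have "card ((X - S') \<union> T') \<le> card (N 1 (S0 \<union> S'))"
      using card_mono[OF finN] by simp
    moreover have "card ((X - S') \<union> T') = card (X - S') + card T'"
      using fin T by (intro card_Un_disjoint) (auto simp: T'_def)
    moreover have "card X - m \<le> card (X - S')"
      using diff_card_le_card_Diff[OF S'(3), of X] S'(2) by simp
    moreover have "2 * card (N 1 (S0 \<union> S')) < card V + 2 * m"
      using S0S' by (intro nobias) auto
    \<comment> \<open>\<open>X - S'\<close> has more than n/2 - 4m elements and \<open>T'\<close>
      more than 9m, disjointly: together more than n/2 + 5m, against the bound n/2 + m.\<close>
    ultimately show False
      using T' XY Y card_Un_le[of X Y] by linarith
  qed
  then show ?thesis
    using that unfolding N_def by (meson not_less)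
qed

section \<open>The union bound for the random graph\<close>

lemma prob_no_edge_in:
  assumes "finite A" "K \<subseteq> A" "0 \<le> p" "p \<le> 1"
  shows "measure_pmf.prob (Pi_pmf A False (\<lambda>_. bernoulli_pmf p)) {f. \<forall>e\<in>K. \<not> f e} = (1 - p) ^ card K"
proof -
  \<comment> \<open>The event is a box, forced to \<open>False\<close> on \<open>K\<close> and free
    elsewhere, so independence turns its probability into a product.\<close>
  have "{f. \<forall>e\<in>K. \<not> f e} = Pi A (\<lambda>e. if e \<in> K then {False} else UNIV)"
    using assms(2) by (auto simp: Pi_def)
  then have "measure_pmf.prob (Pi_pmf A False (\<lambda>_. bernoulli_pmf p)) {f. \<forall>e\<in>K. \<not> f e} =
    (\<Prod>e\<in>A. measure_pmf.prob (bernoulli_pmf p) (if e \<in> K then {False} else UNIV))"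
    by (simp only: measure_Pi_pmf_Pi[OF assms(1)])
  also have "\<dots> = (\<Prod>e\<in>A. if e \<in> K then 1 - p else 1)"
    using assms(3,4) by (intro prod.cong) (auto simp: measure_pmf_single)
  also have "\<dots> = (1 - p) ^ card K"
    using assms(1,2) by (simp add: prod.If_cases Int_absorb1)
  finally show ?thesis .
qed

lemma one_minus_power_le_exp:
  fixes p :: real
  assumes "0 \<le> p" "p \<le> 1" "m \<le> k"
  shows "(1 - p) ^ k \<le> exp (- p * real m)"
proof -
  have "(1 - p) ^ k \<le> (1 - p) ^ m"
    using assms by (intro power_decreasing) auto
  also have "\<dots> \<le> exp (- p) ^ m"
    using assms exp_ge_add_one_self[of "- p"] by (intro power_mono) auto
  also have "\<dots> = exp (- p * real m)"
    by (simp add: mult.commute flip: exp_of_nat_mult)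
  finally show ?thesis .
qed

text \<open>Union bound over at most \<open>4 ^ n\<close> pairs of disjoint sets. \<open>K\<close>
  collects the pairs crossing between \<open>A\<close> and \<open>B\<close>; disjointness makes
  these \<open>card A * card B\<close> distinct potential edges, all absent in the bad
  event.\<close>

lemma prob_not_joined_le:
  assumes "0 \<le> p" "p \<le> 1"
  shows "measure_pmf.prob (binomial_random_graph n p) {E. \<not> joined m {1..n} E} \<le>
    4 ^ n * exp (- p * real (m * m))"
proof -
  define V where "V = {1..n}"
  have finV: "finite (vertex_pairs V)" by (simp add: V_def finite_vertex_pairs)
  define M where "M = Pi_pmf (vertex_pairs V) False (\<lambda>_. bernoulli_pmf p)"
  define I where "I = {(A, B). A \<subseteq> V \<and> B \<subseteq> V \<and> A \<inter> B = {} \<and> m \<le> card A \<and> m \<le> card B}"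
  define K where "K = (\<lambda>(A, B). (\<lambda>(a, b). {a, b}) ` (A \<times> B) :: nat set set)"
  have I: "I \<subseteq> Pow V \<times> Pow V" by (auto simp: I_def)
  then have finI: "finite I"
    by (rule finite_subset) (simp add: V_def)
  have "card I \<le> card (Pow V \<times> Pow V)"
    using I by (intro card_mono) (auto simp: V_def)
  then have cardI: "card I \<le> 4 ^ n"
    by (simp add: card_cartesian_product card_Pow V_def flip: power_mult_distrib)
  have K: "K i \<subseteq> vertex_pairs V" "m * m \<le> card (K i)" if iI: "i \<in> I" for i
  proof -
    obtain A B where i: "i = (A, B)" "A \<subseteq> V" "B \<subseteq> V" "A \<inter> B = {}" "m \<le> card A" "m \<le> card B"
      using iI by (auto simp: I_def)
    show "K i \<subseteq> vertex_pairs V"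
    proof
      fix e assume "e \<in> K i"
      then obtain a b where ab: "a \<in> A" "b \<in> B" "e = {a, b}"
        using i(1) by (auto simp: K_def)
      then have "a \<noteq> b" using i(4) by blast
      then show "e \<in> vertex_pairs V"
        using ab i(2,3) by (auto simp: vertex_pairs_def)
    qed
    have "inj_on (\<lambda>(a, b). {a, b}) (A \<times> B)"
      using i(4) by (auto simp: inj_on_def doubleton_eq_iff)
    then have "card (K i) = card A * card B"
      using i(1) by (simp add: K_def card_image card_cartesian_product)
    then show "m * m \<le> card (K i)"
      using i by (simp add: mult_le_mono)
  qed
  have "measure_pmf.prob (binomial_random_graph n p) {E. \<not> joined m {1..n} E} =
    measure_pmf.prob M {f. \<not> joined m V {e \<in> vertex_pairs V. f e}}"
    by (simp add: binomial_random_graph_def M_def V_def vimage_def)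
  also have "\<dots> \<le> measure_pmf.prob M (\<Union>i\<in>I. {f. \<forall>e\<in>K i. \<not> f e})"
  proof (intro measure_pmf.finite_measure_mono subsetI)
    fix f assume "f \<in> {f. \<not> joined m V {e \<in> vertex_pairs V. f e}}"
    then obtain A B where AB: "(A, B) \<in> I" "\<forall>a\<in>A. \<forall>b\<in>B. {a, b} \<notin> {e \<in> vertex_pairs V. f e}"
      unfolding joined_def I_def by blast
    have "\<forall>e\<in>K (A, B). \<not> f e"
      using AB(2) K(1)[OF AB(1)] by (auto simp: K_def)
    then show "f \<in> (\<Union>i\<in>I. {f. \<forall>e\<in>K i. \<not> f e})"
      using AB(1) by blast
  qed simp
  also have "\<dots> \<le> (\<Sum>i\<in>I. measure_pmf.prob M {f. \<forall>e\<in>K i. \<not> f e})"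
    using finI by (intro measure_pmf.finite_measure_subadditive_finite) auto
  also have "\<dots> \<le> (\<Sum>i\<in>I. exp (- p * real (m * m)))"
  proof (rule sum_mono)
    fix i assume i: "i \<in> I"
    show "measure_pmf.prob M {f. \<forall>e\<in>K i. \<not> f e} \<le> exp (- p * real (m * m))"
      using prob_no_edge_in[OF finV K(1)[OF i] assms] one_minus_power_le_exp[OF assms K(2)[OF i]]
      by (simp add: M_def)
  qed
  also have "\<dots> = real (card I) * exp (- p * real (m * m))"
    by simp
  also have "\<dots> \<le> 4 ^ n * exp (- p * real (m * m))"
    using of_nat_mono[OF cardI, where 'a = real] by (intro mult_right_mono) simp_all
  finally show ?thesis .
qed

section \<open>Choice of constants and conclusion\<close>

lemma leafy_discrepant_forest_if_joined:
  assumes "\<alpha> < 1 / 5" "n \<ge> 100" "E \<subseteq> vertex_pairs {1..n}" "joined (n div 100) {1..n} E"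
    and "\<forall>e\<in>E. col e \<in> {1, - 1 :: int}"
  shows "\<exists>F\<in>leafy_spanning_forests \<alpha> {1..n} E. real_of_int \<bar>\<Sum>e\<in>F. col e\<bar> \<ge> 1 / 100 * real n"
proof -
  define m where "m = n div 100"
  have m: "100 * m \<le> n" "n < 100 * m + 100" "1 \<le> m"
    using assms(2) by (auto simp: m_def)
  obtain S c where S: "S \<subseteq> {1..n}" "m \<le> card S" "card S \<le> 11 * m" "c \<in> {1, - 1}"
    "card {1..n} + 2 * m \<le> 2 * card (colour_nbrs {1..n} E col c S)"
    using joined_imp_biased_nbrs[of "{1..n}" m E col] assms(4,5) m(1) by (auto simp: m_def)
  obtain F where F: "F \<in> max_spanning_forests {1..n} E"
    "card {1..n} \<le> card (leaves {1..n} F) + 3 * (card S + m)"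
    "2 * int (card (colour_nbrs {1..n} E col c S)) - int (card {1..n}) \<le> \<bar>\<Sum>e\<in>F. col e\<bar>"
    using discrepant_forest_if_biased_nbrs[of "{1..n}" E m col S c] assms(3-5) S
    by (auto simp: m_def)
  \<comment> \<open>\<open>3 * (card S + m)\<close> is at most \<open>36 * m\<close>, so at least 64
    percent of the vertices are leaves.\<close>
  have "n \<le> 5 * card (leaves {1..n} F)"
    using F(2) S(3) m by simp
  from of_nat_mono[OF this, where 'a = real]
  have "real n \<le> 5 * real (card (leaves {1..n} F))"
    by simp
  moreover have "\<alpha> * real n \<le> 1 / 5 * real n"
    using assms(1) by (intro mult_right_mono) auto
  ultimately have "F \<in> leafy_spanning_forests \<alpha> {1..n} E"
    using F(1) by (simp add: leafy_spanning_forests_def)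
  moreover have "real_of_int \<bar>\<Sum>e\<in>F. col e\<bar> \<ge> 1 / 100 * real n"
  proof -
    \<comment> \<open>The colour sum is at least \<open>2 * m\<close> in absolute value, and
      \<open>n < 100 * m + 100 \<le> 200 * m\<close>.\<close>
    have "int n \<le> 100 * \<bar>\<Sum>e\<in>F. col e\<bar>"
      using F(3) S(5) m by simp
    then have "real_of_int (int n) \<le> real_of_int (100 * \<bar>\<Sum>e\<in>F. col e\<bar>)"
      by (simp only: of_int_le_iff)
    then show ?thesis by simp
  qed
  ultimately show ?thesis by blast
qed

theorem theorem1p2:
  fixes \<alpha> :: real
  assumes "0 < \<alpha>" and "\<alpha> < 1 / 5"
  shows "\<exists>\<epsilon> > 0. \<exists>C > 0. \<forall>p :: nat \<Rightarrow> real.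
    (\<forall>n. 0 \<le> p n \<and> p n \<le> 1) \<longrightarrow>
    (\<forall>\<^sub>F n in sequentially. p n \<ge> C / real n) \<longrightarrow>
    (\<lambda>n. measure_pmf.prob (binomial_random_graph n (p n))
       {E. \<forall>col :: nat set \<Rightarrow> int. (\<forall>e \<in> E. col e \<in> {1, -1}) \<longrightarrow>
          (\<exists>F \<in> leafy_spanning_forests \<alpha> {1..n} E.
             real_of_int \<bar>(\<Sum>e\<in>F. col e)\<bar> \<ge> \<epsilon> * real n)})
      \<longlonglongrightarrow> 1"
proof (rule exI[of _ "1 / 100"], rule conjI[rotated], rule exI[of _ "160000"], intro conjI allI impI)
  fix p :: "nat \<Rightarrow> real"
  assume p01: "\<forall>n. 0 \<le> p n \<and> p n \<le> 1"
    and large: "\<forall>\<^sub>F n in sequentially. p n \<ge> 160000 / real n"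
  define good where "good = (\<lambda>n. {E. \<forall>col :: nat set \<Rightarrow> int. (\<forall>e \<in> E. col e \<in> {1, -1}) \<longrightarrow>
          (\<exists>F \<in> leafy_spanning_forests \<alpha> {1..n} E.
             real_of_int \<bar>(\<Sum>e\<in>F. col e)\<bar> \<ge> 1 / 100 * real n)})"
  define pr where "pr = (\<lambda>n. measure_pmf.prob (binomial_random_graph n (p n)))"
  have bound: "1 - (4 / 5) ^ n \<le> pr n (good n)" if n: "n \<ge> 100" "p n \<ge> 160000 / real n" for n
  proof -
    define m where "m = n div 100"
    have "n < 100 * m + 100" "1 \<le> m" using n(1) by (auto simp: m_def)
    \<comment> \<open>Since 160000 = 4 * 200 * 200, this makes the exponent
      \<open>p n * m * m\<close> at least \<open>4 * n\<close>; as \<open>exp 4 \<ge> 5\<close>, the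
      exponential beats the \<open>4 ^ n\<close> pairs.\<close>
    then have "n \<le> 200 * m" by linarith
    then have "n * n \<le> (200 * m) * (200 * m)" by (intro mult_le_mono)
    from of_nat_mono[OF this, where 'a = real]
    have m: "real n * real n \<le> 40000 * real (m * m)"
      by simp
    have "4 * real n = 160000 / real n * (real n * real n / 40000)"
      using n(1) by simp
    also have "\<dots> \<le> p n * real (m * m)"
      using n m p01 by (intro mult_mono) auto
    finally have "exp (- p n * real (m * m)) \<le> exp (real n * (- 4))"
      by simp
    also have "\<dots> = exp (- 4) ^ n"
      by (rule exp_of_nat_mult)
    also have "\<dots> \<le> (1 / 5) ^ n"
    proof (rule power_mono)
      have "5 \<le> exp (4 :: real)"
        using exp_ge_add_one_self[of 4] by simp
      then show "exp (- 4) \<le> (1 / 5 :: real)"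
        by (simp add: exp_minus field_simps)
    qed simp
    finally have "4 ^ n * exp (- p n * real (m * m)) \<le> 4 ^ n * (1 / 5) ^ n"
      by simp
    also have "\<dots> = (4 / 5) ^ n"
      by (simp flip: power_mult_distrib)
    finally have "pr n {E. \<not> joined m {1..n} E} \<le> (4 / 5) ^ n"
      using prob_not_joined_le[of "p n" n m] p01 by (simp add: pr_def)
    \<comment> \<open>The inclusion is only almost sure:
      \<open>E \<subseteq> vertex_pairs {1..n}\<close>, needed for the deterministic lemma, is known
      on the support.\<close>
    moreover have "pr n (- good n) \<le> pr n {E. \<not> joined m {1..n} E}"
      unfolding pr_def
    proof (rule measure_pmf.finite_measure_mono_AE)
      show "AE E in binomial_random_graph n (p n). E \<in> - good n \<longrightarrow> E \<in> {E. \<not> joined m {1..n} E}"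
      proof (rule AE_pmfI, intro impI)
        fix E assume "E \<in> set_pmf (binomial_random_graph n (p n))" and "E \<in> - good n"
        then show "E \<in> {E. \<not> joined m {1..n} E}"
          using leafy_discrepant_forest_if_joined[OF assms(2) n(1), of E]
          by (auto simp: good_def m_def binomial_random_graph_def)
      qed
    qed simp
    moreover have "pr n (- good n) = 1 - pr n (good n)"
      unfolding pr_def using measure_pmf.prob_compl[of "good n"] by (simp add: Compl_eq_Diff_UNIV)
    ultimately show ?thesis by linarith
  qed
  have "\<forall>\<^sub>F n in sequentially. 1 - (4 / 5) ^ n \<le> pr n (good n)"
    using large eventually_ge_at_top[of "100 :: nat"]
    by eventually_elim (rule bound)
  moreover have "\<forall>\<^sub>F n in sequentially. pr n (good n) \<le> 1"
    by (simp add: pr_def)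
  moreover have "(\<lambda>n. 1 - (4 / 5 :: real) ^ n) \<longlonglongrightarrow> 1"
    using tendsto_diff[OF tendsto_const[of 1] LIMSEQ_realpow_zero[of "4 / 5 :: real"]] by simp
  ultimately have "(\<lambda>n. pr n (good n)) \<longlonglongrightarrow> 1"
    by (rule tendsto_sandwich[OF _ _ _ tendsto_const])
  then show "(\<lambda>n. measure_pmf.prob (binomial_random_graph n (p n))
       {E. \<forall>col :: nat set \<Rightarrow> int. (\<forall>e \<in> E. col e \<in> {1, -1}) \<longrightarrow>
          (\<exists>F \<in> leafy_spanning_forests \<alpha> {1..n} E.
             real_of_int \<bar>(\<Sum>e\<in>F. col e)\<bar> \<ge> 1 / 100 * real n)})
      \<longlonglongrightarrow> 1"
    by (simp only: pr_def good_def)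
qed simp_all

end
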